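(* Let $G(N,E)$ be a finite undirected graph and let $\{s_1,\dots,s_r\}\subseteq N$ be a set of $r$ distinct nodes (the reference generators). Let $\mathcal{I}$ be the collection of bases of the graphic matroid of the augmented graph $G_0$, i.e. the collection of all spanning trees (as edge sets) of $G_0$. A set of edges $S\subseteq E$ induces a partition of the graph, $S=\bigcup_{k=1}^rS_k$, $N=\bigcup_{k=1}^rN_k$ with $S_i\cap S_j=\emptyset$ and $N_i\cap N_j=\emptyset$ for all $i\ne j$, where each reference generator satisfies $s_k\in N_k$ for all $k$, if $$S\cup\{(0,s_i):\ i=1,\dots,r\}\in\mathcal{I}.$$
   Context: The augmented graph $G_0(N_0,E_0)$ is obtained from $G$ by adding a new node $0\notin N$ and joining it to all reference generators: $N_0=N\cup\{0\}$, $E_0=E\cup\{(0,s_i): i=1,\dots,r\}$. "S induces a partition" means that the graph $(N,S)$ splits into $r$ disjoint subgraphs (islands) $G(N_k,S_k)$, $k=1,\dots,r$, which are its connected components, with every edge of $S_k$ having both endpoints in $N_k$. *)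

theory Defs
  imports Main
begin

(* An undirected graph is a vertex set together with a set of edges, an edge being the set of its
   endpoints; a singleton edge {v} is a loop. *)
definition ugraph :: "'a set \<Rightarrow> 'a set set \<Rightarrow> bool" where
  "ugraph N E \<longleftrightarrow> finite N \<and> (\<forall>e\<in>E. \<exists>u\<in>N. \<exists>v\<in>N. e = {u, v})"

definition subgraph :: "'a set \<Rightarrow> 'a set set \<Rightarrow> 'a set \<Rightarrow> 'a set set \<Rightarrow> bool" where
  "subgraph N' E' N E \<longleftrightarrow> N' \<subseteq> N \<and> E' \<subseteq> E \<and> ugraph N' E'"

definition graph_reachable :: "'a set set \<Rightarrow> 'a \<Rightarrow> 'a \<Rightarrow> bool" where
  "graph_reachable E = (\<lambda>u v. {u, v} \<in> E)\<^sup>*\<^sup>*"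

definition graph_connected :: "'a set \<Rightarrow> 'a set set \<Rightarrow> bool" where
  "graph_connected N E \<longleftrightarrow> N \<noteq> {} \<and> (\<forall>u\<in>N. \<forall>v\<in>N. graph_reachable E u v)"

definition cycle_edges :: "'a list \<Rightarrow> 'a set list" where
  "cycle_edges vs = map2 (\<lambda>u v. {u, v}) vs (rotate1 vs)"

(* Distinctness of the edges excludes traversing one edge back and forth; a loop is a cycle of
   length one. *)
definition graph_cycle :: "'a set set \<Rightarrow> 'a list \<Rightarrow> bool" where
  "graph_cycle E vs \<longleftrightarrow>
     vs \<noteq> [] \<and> distinct vs \<and> distinct (cycle_edges vs) \<and> set (cycle_edges vs) \<subseteq> E"

definition forest :: "'a set set \<Rightarrow> bool" where
  "forest F \<longleftrightarrow> (\<nexists>vs. graph_cycle F vs)"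

definition spanning_trees :: "'a set \<Rightarrow> 'a set set \<Rightarrow> 'a set set set" where
  "spanning_trees N E = {T. T \<subseteq> E \<and> graph_connected N T \<and> forest T}"

definition graphic_matroid_bases :: "'a set set \<Rightarrow> 'a set set set" where
  "graphic_matroid_bases E =
     {B. B \<subseteq> E \<and> forest B \<and> (\<forall>F. F \<subseteq> E \<and> forest F \<and> B \<subseteq> F \<longrightarrow> F = B)}"

(* Connected components as maximal connected subgraphs (vertex set, edge set). *)
definition graph_components :: "'a set \<Rightarrow> 'a set set \<Rightarrow> ('a set \<times> 'a set set) set" where
  "graph_components N E = {(C, F). subgraph C F N E \<and> graph_connected C F \<and>
     (\<forall>C' F'. subgraph C' F' N E \<and> graph_connected C' F' \<and> C \<subseteq> C' \<and> F \<subseteq> F'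
        \<longrightarrow> C' = C \<and> F' = F)}"

definition reference_edges :: "'a \<Rightarrow> (nat \<Rightarrow> 'a) \<Rightarrow> nat \<Rightarrow> 'a set set" where
  "reference_edges z s r = {{z, s i} | i. i \<in> {1..r}}"

(* The augmented graph; z plays the role of the new node 0. *)
definition augmented_nodes :: "'a \<Rightarrow> 'a set \<Rightarrow> 'a set" where
  "augmented_nodes z N = N \<union> {z}"

definition augmented_edges :: "'a \<Rightarrow> (nat \<Rightarrow> 'a) \<Rightarrow> nat \<Rightarrow> 'a set set \<Rightarrow> 'a set set" where
  "augmented_edges z s r E = E \<union> reference_edges z s r"

definition induces_partition :: "'a set \<Rightarrow> 'a set set \<Rightarrow> (nat \<Rightarrow> 'a) \<Rightarrow> nat \<Rightarrow> bool" where
  "induces_partition N S s r \<longleftrightarrow> (\<exists>Nk Sk.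
     S = (\<Union>k\<in>{1..r}. Sk k) \<and> N = (\<Union>k\<in>{1..r}. Nk k) \<and>
     (\<forall>i\<in>{1..r}. \<forall>j\<in>{1..r}. i \<noteq> j \<longrightarrow> Sk i \<inter> Sk j = {} \<and> Nk i \<inter> Nk j = {}) \<and>
     (\<forall>k\<in>{1..r}. \<forall>e\<in>Sk k. e \<subseteq> Nk k) \<and>
     graph_components N S = (\<lambda>k. (Nk k, Sk k)) ` {1..r} \<and>
     (\<forall>k\<in>{1..r}. s k \<in> Nk k))"


(* In a connected graph the bases of the graphic matroid are exactly the spanning trees. *)

lemma cycle_edges_snoc:
  "cycle_edges (x # xs) = map2 (\<lambda>u v. {u, v}) (x # xs) (xs @ [x])"
  by (simp add: cycle_edges_def)

lemma length_cycle_edges [simp]: "length (cycle_edges vs) = length vs"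
  by (simp add: cycle_edges_def)

lemma cycle_edges_rotate1: "cycle_edges (rotate1 vs) = rotate1 (cycle_edges vs)"
proof (cases vs)
  case (Cons x xs)
  then show ?thesis
  proof (cases xs)
    case (Cons y ys)
    then show ?thesis
      using \<open>vs = x # xs\<close> zip_append[of "y # ys" "ys @ [x]" "[x]" "[y]"]
      by (simp add: cycle_edges_def)
  qed (simp add: cycle_edges_def)
qed (simp add: cycle_edges_def)

lemma cycle_edges_rotate: "cycle_edges (rotate n vs) = rotate n (cycle_edges vs)"
  by (induction n) (simp_all add: cycle_edges_rotate1)

lemma graph_cycle_rotate: "graph_cycle E vs \<Longrightarrow> graph_cycle E (rotate n vs)"
  by (simp add: graph_cycle_def cycle_edges_rotate)

definition walk_edges :: "'a list \<Rightarrow> 'a set list" where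
  "walk_edges vs = map2 (\<lambda>u v. {u, v}) vs (tl vs)"

lemma walk_edges_simps [simp]:
  "walk_edges [] = []" "walk_edges [x] = []"
  "walk_edges (x # y # ys) = {x, y} # walk_edges (y # ys)"
  by (simp_all add: walk_edges_def)

lemma cycle_edges_walk: "vs \<noteq> [] \<Longrightarrow> cycle_edges vs = walk_edges vs @ [{last vs, hd vs}]"
proof -
  have "map2 (\<lambda>u v. {u, v}) (x # xs) (xs @ [y]) = walk_edges (x # xs) @ [{last (x # xs), y}]"
    for x y :: 'a and xs
    by (induction xs arbitrary: x) auto
  then show "vs \<noteq> [] \<Longrightarrow> ?thesis" by (cases vs) (auto simp: cycle_edges_snoc)
qed

lemma walk_edges_subset: "e \<in> set (walk_edges vs) \<Longrightarrow> e \<subseteq> set vs"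
  by (induction vs rule: induct_list012) auto

lemma distinct_walk_edges: "distinct vs \<Longrightarrow> distinct (walk_edges vs)"
  by (induction vs rule: induct_list012) (auto dest: walk_edges_subset)

lemma graph_reachable_sym: "graph_reachable E u v \<Longrightarrow> graph_reachable E v u"
proof -
  have "symp (\<lambda>u v. {u, v} \<in> E)" by (simp add: symp_def insert_commute)
  then show "graph_reachable E u v \<Longrightarrow> graph_reachable E v u"
    unfolding graph_reachable_def by (meson symp_rtranclp sympD)
qed

lemma walk_reachable:
  "vs \<noteq> [] \<Longrightarrow> set (walk_edges vs) \<subseteq> E \<Longrightarrow> graph_reachable E (hd vs) (last vs)"
  unfolding graph_reachable_def
  by (induction vs rule: induct_list012) (auto intro: converse_rtranclp_into_rtranclp)

lemma reachable_path:
  assumes "graph_reachable E u v"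
  shows "\<exists>vs. vs \<noteq> [] \<and> distinct vs \<and> hd vs = u \<and> last vs = v \<and> set (walk_edges vs) \<subseteq> E"
  using assms unfolding graph_reachable_def
proof (induction rule: converse_rtranclp_induct)
  case base
  show ?case by (rule exI[of _ "[v]"]) simp
next
  case (step x y)
  then obtain vs where vs: "vs \<noteq> []" "distinct vs" "hd vs = y" "last vs = v"
    "set (walk_edges vs) \<subseteq> E" by blast
  show ?case
  proof (cases "x \<in> set vs")
    case False
    have "walk_edges (x # vs) = {x, y} # walk_edges vs" using vs by (cases vs) auto
    with False vs step.hyps show ?thesis by (intro exI[of _ "x # vs"]) auto
  next
    case True
    then obtain as bs where ab: "vs = as @ x # bs" by (auto simp: in_set_conv_decomp)
    have "set (walk_edges (x # bs)) \<subseteq> set (walk_edges (as @ x # bs))"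
    proof (induction as)
      case (Cons a as)
      then show ?case by (cases as) auto
    qed simp
    with ab vs show ?thesis by (intro exI[of _ "x # bs"]) auto
  qed
qed

lemma forest_mono: "forest F \<Longrightarrow> T \<subseteq> F \<Longrightarrow> forest T"
  unfolding forest_def graph_cycle_def by (meson subset_trans)

lemma forest_insert_iff:
  assumes "forest T" "{u, v} \<notin> T"
  shows "forest (insert {u, v} T) \<longleftrightarrow> \<not> graph_reachable T u v"
proof
  assume f: "forest (insert {u, v} T)"
  show "\<not> graph_reachable T u v"
  proof
    assume "graph_reachable T u v"
    from reachable_path[OF this] obtain vs where vs: "vs \<noteq> []" "distinct vs" "hd vs = u"
      "last vs = v" "set (walk_edges vs) \<subseteq> T" by blast
    then have "graph_cycle (insert {u, v} T) vs"
      using assms(2)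
      by (auto simp: graph_cycle_def cycle_edges_walk distinct_walk_edges insert_commute)
    with f show False by (auto simp: forest_def)
  qed
next
  assume nr: "\<not> graph_reachable T u v"
  show "forest (insert {u, v} T)"
  proof (rule ccontr)
    assume "\<not> forest (insert {u, v} T)"
    then obtain vs where c: "graph_cycle (insert {u, v} T) vs" by (auto simp: forest_def)
    have "{u, v} \<in> set (cycle_edges vs)"
      using c assms(1) unfolding forest_def graph_cycle_def by blast
    then obtain i where i: "i < length vs" "cycle_edges vs ! i = {u, v}"
      by (auto simp: in_set_conv_nth)
    define ws where "ws = rotate (Suc i) vs"
    have cw: "graph_cycle (insert {u, v} T) ws"
      unfolding ws_def by (rule graph_cycle_rotate[OF c])
    then have ne: "ws \<noteq> []" by (simp add: graph_cycle_def)
    have len: "length ws = length vs" by (simp add: ws_def)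
    have "cycle_edges ws = rotate (Suc i) (cycle_edges vs)"
      unfolding ws_def by (rule cycle_edges_rotate)
    then have "last (cycle_edges ws) = rotate (Suc i) (cycle_edges vs) ! (length vs - 1)"
      using ne len by (metis last_conv_nth length_0_conv length_cycle_edges)
    also have "\<dots> = cycle_edges vs ! ((Suc i + (length vs - 1)) mod length vs)"
      using i by (subst nth_rotate) auto
    also have "Suc i + (length vs - 1) = i + length vs" using i by simp
    finally have "last (cycle_edges ws) = {u, v}" using i by simp
    then have l: "{last ws, hd ws} = {u, v}" by (simp add: cycle_edges_walk[OF ne])
    with cw ne have "set (walk_edges ws) \<subseteq> T"
      by (auto simp: graph_cycle_def cycle_edges_walk)
    then have "graph_reachable T (hd ws) (last ws)" by (rule walk_reachable[OF ne])
    with l nr show False by (metis doubleton_eq_iff graph_reachable_sym)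
  qed
qed

lemma spanning_trees_eq_bases:
  assumes "ugraph N E" "graph_connected N E"
  shows "spanning_trees N E = graphic_matroid_bases E"
proof (intro set_eqI iffI)
  fix T assume "T \<in> spanning_trees N E"
  then have T: "T \<subseteq> E" "graph_connected N T" "forest T" by (auto simp: spanning_trees_def)
  have "F = T" if F: "F \<subseteq> E" "forest F" "T \<subseteq> F" for F
  proof (rule ccontr)
    assume "F \<noteq> T"
    then obtain e where e: "e \<in> F" "e \<notin> T" using F by blast
    then obtain u v where uv: "u \<in> N" "v \<in> N" "e = {u, v}"
      using assms(1) F unfolding ugraph_def by blast
    then have "graph_reachable T u v" using T by (auto simp: graph_connected_def)
    then have "\<not> forest (insert e T)"
      using forest_insert_iff[of T u v] T(3) uv(3) e(2) by simp
    moreover have "forest (insert e T)" using forest_mono[OF F(2)] F(3) e(1) by simp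
    ultimately show False ..
  qed
  then show "T \<in> graphic_matroid_bases E" using T by (auto simp: graphic_matroid_bases_def)
next
  fix T assume "T \<in> graphic_matroid_bases E"
  then have T: "T \<subseteq> E" "forest T"
    and mx: "\<And>F. F \<subseteq> E \<Longrightarrow> forest F \<Longrightarrow> T \<subseteq> F \<Longrightarrow> F = T"
    by (auto simp: graphic_matroid_bases_def)
  have edge: "graph_reachable T u v" if e: "{u, v} \<in> E" for u v
  proof (cases "{u, v} \<in> T")
    case True
    then show ?thesis by (auto simp: graph_reachable_def)
  next
    case False
    then have "\<not> forest (insert {u, v} T)" using mx[of "insert {u, v} T"] T(1) e by blast
    then show ?thesis using forest_insert_iff[OF T(2) False] by simp
  qed
  have "graph_reachable T u v" if "graph_reachable E u v" for u v
    using that unfolding graph_reachable_def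
  proof (induction rule: rtranclp_induct)
    case (step y z)
    then show ?case using edge[of y z] unfolding graph_reachable_def by (meson rtranclp_trans)
  qed simp
  then show "T \<in> spanning_trees N E"
    using T assms(2) by (auto simp: spanning_trees_def graph_connected_def)
qed

end

theory Submission
  imports Defs
begin

text \<open>Every node of \<open>N\<close> is joined to the new node by a path in the spanning tree; its last
  reference edge ends in some \<open>s k\<close>, and from there on the path runs in \<open>S\<close>, so every component of
  \<open>(N, S)\<close> contains a reference generator. Two generators in the same component would close a
  cycle through the new node, so no component contains two of them.\<close>

lemma graph_reachable_refl [simp]: "graph_reachable E v v"
  by (simp add: graph_reachable_def)

lemma graph_reachable_trans:
  "graph_reachable E u v \<Longrightarrow> graph_reachable E v w \<Longrightarrow> graph_reachable E u w"
  unfolding graph_reachable_def by (rule rtranclp_trans)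

lemma graph_reachable_edge: "{u, v} \<in> E \<Longrightarrow> graph_reachable E u v"
  unfolding graph_reachable_def by blast

lemma graph_reachable_mono: "graph_reachable E u v \<Longrightarrow> E \<subseteq> F \<Longrightarrow> graph_reachable F u v"
  unfolding graph_reachable_def by (erule rtranclp_mono[THEN predicate2D, rotated]) blast

lemma graph_reachable_induct [consumes 1, case_names refl step]:
  assumes "graph_reachable E u v" and "P u"
    and "\<And>x y. graph_reachable E u x \<Longrightarrow> {x, y} \<in> E \<Longrightarrow> P x \<Longrightarrow> P y"
  shows "P v"
  using assms unfolding graph_reachable_def by (rule rtranclp_induct)

lemma ugraph_subset: "ugraph N E \<Longrightarrow> S \<subseteq> E \<Longrightarrow> ugraph N S"
  unfolding ugraph_def by blast

lemma ugraph_edgeE: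
  assumes "ugraph N E" "e \<in> E"
  obtains u v where "u \<in> N" "v \<in> N" "e = {u, v}"
  using assms unfolding ugraph_def by blast

text \<open>Reachability is reflexive at every element of the type, so the restriction to
  \<open>N\<close> is what keeps this set inside the graph even if \<open>v\<close> is not a
  node.\<close>

definition reach_set :: "'a set \<Rightarrow> 'a set set \<Rightarrow> 'a \<Rightarrow> 'a set" where
  "reach_set N E v = {w \<in> N. graph_reachable E v w}"

definition induced_edges :: "'a set set \<Rightarrow> 'a set \<Rightarrow> 'a set set" where
  "induced_edges E C = {e \<in> E. e \<subseteq> C}"

lemma reach_set_eq: "graph_reachable E u v \<Longrightarrow> reach_set N E u = reach_set N E v"
  unfolding reach_set_def by (blast intro: graph_reachable_trans graph_reachable_sym)

lemma edge_subset_reach_set: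
  assumes "ugraph N E" "e \<in> E" "u \<in> e"
  shows "e \<subseteq> reach_set N E u"
proof -
  obtain x y where "x \<in> N" "y \<in> N" "e = {x, y}"
    using assms(1,2) by (rule ugraph_edgeE)
  then show ?thesis
    using assms(2,3) graph_reachable_edge[of x y E] graph_reachable_edge[of y x E]
    by (auto simp: reach_set_def insert_commute)
qed

lemma subgraph_reach_set:
  assumes "ugraph N E"
  shows "subgraph (reach_set N E v) (induced_edges E (reach_set N E v)) N E"
  using assms
  by (fastforce simp: subgraph_def ugraph_def reach_set_def induced_edges_def)

text \<open>A walk from \<open>v\<close> never leaves the reach set of \<open>v\<close>, so by
  induction along the walk all its edges are induced ones. Any two nodes of the set are then joined
  through \<open>v\<close>.\<close>

lemma connected_reach_set:
  assumes "ugraph N E" "v \<in> N"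
  shows "graph_connected (reach_set N E v) (induced_edges E (reach_set N E v))"
proof -
  let ?F = "induced_edges E (reach_set N E v)"
  have *: "graph_reachable ?F v w" if "graph_reachable E v w" for w
    using that
  proof (induction rule: graph_reachable_induct)
    case (step x y)
    from edge_subset_reach_set[OF assms(1) step(2), of x] reach_set_eq[OF step(1), of N]
    have "{x, y} \<in> ?F" using step(2) by (simp add: induced_edges_def)
    then show ?case using step(3) by (blast intro: graph_reachable_trans graph_reachable_edge)
  qed simp
  then have "graph_reachable ?F u w" if "u \<in> reach_set N E v" "w \<in> reach_set N E v" for u w
    using that unfolding reach_set_def[of N E v]
    by (blast intro: graph_reachable_trans graph_reachable_sym)
  moreover have "v \<in> reach_set N E v" using assms(2) by (simp add: reach_set_def)
  ultimately show ?thesis by (auto simp: graph_connected_def)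
qed

lemma connected_subgraph_reach_set:
  assumes "subgraph C F N E" "graph_connected C F" "v \<in> C"
  shows "C \<subseteq> reach_set N E v" "F \<subseteq> induced_edges E (reach_set N E v)"
proof -
  show C: "C \<subseteq> reach_set N E v"
    using assms graph_reachable_mono[of F v _ E]
    by (auto simp: subgraph_def graph_connected_def reach_set_def)
  show "F \<subseteq> induced_edges E (reach_set N E v)"
    using assms(1) C by (fastforce simp: subgraph_def ugraph_def induced_edges_def)
qed

text \<open>The reach set of \<open>v\<close> with its induced edges is the largest connected
  subgraph through \<open>v\<close>. Hence it is maximal, and a maximal connected subgraph coincides
  with the one built from any of its own nodes. This trades maximality for plain
  reachability.\<close>

lemma graph_components_eq:
  assumes "ugraph N E"
  shows "graph_components N E =
    (\<lambda>v. (reach_set N E v, induced_edges E (reach_set N E v))) ` N"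
    (is "_ = ?c ` N")
proof (intro equalityI subrelI subsetI)
  fix C F assume "(C, F) \<in> graph_components N E"
  then have CF: "subgraph C F N E" "graph_connected C F"
    and mx: "\<And>C' F'. subgraph C' F' N E \<Longrightarrow> graph_connected C' F' \<Longrightarrow> C \<subseteq> C' \<Longrightarrow> F \<subseteq> F'
      \<Longrightarrow> C' = C \<and> F' = F"
    by (auto simp: graph_components_def)
  obtain v where v: "v \<in> C" using CF(2) by (auto simp: graph_connected_def)
  then have "v \<in> N" using CF(1) by (auto simp: subgraph_def)
  with mx[OF subgraph_reach_set connected_reach_set connected_subgraph_reach_set[OF CF v]]
  have "?c v = (C, F)" using assms by blast
  with \<open>v \<in> N\<close> show "(C, F) \<in> ?c ` N" by force
next
  fix p assume "p \<in> ?c ` N"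
  then obtain v where v: "v \<in> N" "p = ?c v" by blast
  then have "v \<in> reach_set N E v" by (simp add: reach_set_def)
  then have "\<forall>C' F'. subgraph C' F' N E \<and> graph_connected C' F' \<and> reach_set N E v \<subseteq> C' \<and>
      induced_edges E (reach_set N E v) \<subseteq> F' \<longrightarrow>
      C' = reach_set N E v \<and> F' = induced_edges E (reach_set N E v)"
    by (meson connected_subgraph_reach_set subset_antisym subsetD)
  with v subgraph_reach_set[OF assms] connected_reach_set[OF assms]
  show "p \<in> graph_components N E" by (simp add: graph_components_def)
qed

text \<open>The generators form a system of representatives for reachability in \<open>S\<close>, so
  their reach sets are the islands. This leaves only \<open>cover\<close> and
  \<open>separated\<close> to be drawn from the spanning tree.\<close>

lemma induces_partition_representatives:
  assumes "ugraph N S" and sN: "s ` {1..r} \<subseteq> N"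
    and cover: "\<And>v. v \<in> N \<Longrightarrow> \<exists>k\<in>{1..r}. graph_reachable S (s k) v"
    and separated: "\<And>i j. i \<in> {1..r} \<Longrightarrow> j \<in> {1..r} \<Longrightarrow> i \<noteq> j \<Longrightarrow> \<not> graph_reachable S (s i) (s j)"
  shows "induces_partition N S s r"
proof -
  define Nk where "Nk k = reach_set N S (s k)" for k
  define Sk where "Sk k = induced_edges S (Nk k)" for k
  have disj: "Nk i \<inter> Nk j = {}" if "i \<in> {1..r}" "j \<in> {1..r}" "i \<noteq> j" for i j
    using separated[OF that]
    by (auto simp: Nk_def reach_set_def dest: graph_reachable_sym graph_reachable_trans)
  have N: "N = (\<Union>k\<in>{1..r}. Nk k)"
    using cover by (auto simp: Nk_def reach_set_def)
  have "e \<in> (\<Union>k\<in>{1..r}. Sk k)" if "e \<in> S" for e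
  proof -
    obtain u v where uv: "u \<in> N" "v \<in> N" "e = {u, v}"
      using assms(1) \<open>e \<in> S\<close> by (rule ugraph_edgeE)
    then obtain k where k: "k \<in> {1..r}" "graph_reachable S (s k) u" using cover by blast
    then have "e \<subseteq> Nk k"
      using edge_subset_reach_set[OF assms(1) that, of u] uv reach_set_eq[OF k(2), of N]
      by (simp add: Nk_def)
    with that k(1) show ?thesis by (auto simp: Sk_def induced_edges_def)
  qed
  then have S: "S = (\<Union>k\<in>{1..r}. Sk k)"
    by (auto simp: Sk_def induced_edges_def)
  \<comment> \<open>Nonemptiness matters: an empty edge could lie in two disjoint islands at
    once.\<close>
  have Sk: "e \<subseteq> Nk k" "e \<noteq> {}" if "e \<in> Sk k" for e k
    using that assms(1) by (auto simp: Sk_def induced_edges_def ugraph_def)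
  have Sdisj: "Sk i \<inter> Sk j = {}" if "i \<in> {1..r}" "j \<in> {1..r}" "i \<noteq> j" for i j
    using disj[OF that] Sk by blast
  have comp: "graph_components N S = (\<lambda>k. (Nk k, Sk k)) ` {1..r}"
  proof -
    \<comment> \<open>It suffices to compare node sets, because the edge set of a component is a
      function of its node set. Each node has the same reach set as the generator that reaches
      it.\<close>
    have "reach_set N S ` N = Nk ` {1..r}"
    proof
      show "reach_set N S ` N \<subseteq> Nk ` {1..r}"
        using cover by (auto simp: Nk_def) (metis atLeastAtMost_iff imageI reach_set_eq)
    qed (use sN in \<open>auto simp: Nk_def\<close>)
    then have "(\<lambda>C. (C, induced_edges S C)) ` reach_set N S ` N
        = (\<lambda>C. (C, induced_edges S C)) ` Nk ` {1..r}" by simp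
    then show ?thesis
      by (simp add: graph_components_eq[OF assms(1)] image_image Sk_def)
  qed
  have sk: "\<forall>k\<in>{1..r}. s k \<in> Nk k" using sN by (auto simp: Nk_def reach_set_def)
  show ?thesis
    unfolding induces_partition_def
    by (rule exI[of _ Nk], rule exI[of _ Sk]) (intro conjI S N comp sk ballI impI disj Sdisj Sk(1))
qed

theorem lemma5:
  fixes N :: "'a set" and E S :: "'a set set" and s :: "nat \<Rightarrow> 'a" and r :: nat and z :: 'a
    and \<I> :: "'a set set set"
  assumes "ugraph N E"
    and "inj_on s {1..r}"
    and "s ` {1..r} \<subseteq> N"
    and "z \<notin> N"
    and "\<I> = spanning_trees (augmented_nodes z N) (augmented_edges z s r E)"
    and "S \<subseteq> E"
    and "S \<union> reference_edges z s r \<in> \<I>"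
  shows "induces_partition N S s r"
proof (rule induces_partition_representatives)
  let ?T = "S \<union> reference_edges z s r"
  have con: "graph_connected (N \<union> {z}) ?T" and forest: "forest ?T"
    using assms(5,7) by (auto simp: spanning_trees_def augmented_nodes_def)
  show S: "ugraph N S" using assms(1,6) by (rule ugraph_subset)
  show "s ` {1..r} \<subseteq> N" by fact
  have z: "z \<notin> e" if "e \<in> S" for e
    using S that assms(4) by (auto simp: ugraph_def)
  show "\<exists>k\<in>{1..r}. graph_reachable S (s k) v" if v: "v \<in> N" for v
  proof -
    have "graph_reachable ?T z v" using con v by (auto simp: graph_connected_def)
    \<comment> \<open>The walk may return to \<open>z\<close>, so the induction needs the first
      disjunct.\<close>
    then have "v = z \<or> (\<exists>k\<in>{1..r}. graph_reachable S (s k) v)"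
    proof (induction rule: graph_reachable_induct)
      case (step x y)
      show ?case
      proof (cases "{x, y} \<in> S")
        case True
        \<comment> \<open>Edges of \<open>S\<close> avoid \<open>z\<close>, so the generator found
          for \<open>x\<close> also serves \<open>y\<close>.\<close>
        then have "x \<noteq> z" using z by blast
        with step(3) True show ?thesis
          by (blast intro: graph_reachable_trans graph_reachable_edge)
      next
        case False
        then obtain k where "k \<in> {1..r}" "{x, y} = {z, s k}"
          using step(2) by (auto simp: reference_edges_def)
        \<comment> \<open>A reference edge leads either to \<open>z\<close> or to
          \<open>s k\<close>; in the latter case the walk in \<open>S\<close> starts afresh with
          this \<open>k\<close>.\<close>
        then show ?thesis by (auto simp: doubleton_eq_iff intro: bexI[of _ k])
      qed
    qed simp
    with v assms(4) show ?thesis by blast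
  qed
  show "\<not> graph_reachable S (s i) (s j)"
    if ij: "i \<in> {1..r}" "j \<in> {1..r}" "i \<noteq> j" for i j
  proof
    assume r: "graph_reachable S (s i) (s j)"
    \<comment> \<open>In a forest the ends of a deleted edge become disconnected. Yet
      \<open>z\<close> still reaches \<open>s j\<close> through \<open>s i\<close>, since the walk
      in \<open>S\<close> uses no edge at \<open>z\<close>.\<close>
    let ?T' = "?T - {{z, s j}}"
    have T: "insert {z, s j} ?T' = ?T" using ij by (auto simp: reference_edges_def)
    have "\<not> graph_reachable ?T' z (s j)"
      using forest_insert_iff[of ?T' z "s j"] forest_mono[OF forest, of ?T'] forest T by auto
    \<comment> \<open>Injectivity of \<open>s\<close> ensures that the edge from \<open>z\<close> to
      \<open>s i\<close> is not the deleted one.\<close>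
    moreover have "s i \<noteq> s j" using assms(2) ij by (auto dest: inj_onD)
    then have "{z, s i} \<in> ?T'"
      using ij by (auto simp: reference_edges_def doubleton_eq_iff)
    then have "graph_reachable ?T' z (s i)" by (rule graph_reachable_edge)
    moreover have "graph_reachable ?T' (s i) (s j)"
      using r by (rule graph_reachable_mono) (use z in auto)
    ultimately show False by (blast intro: graph_reachable_trans)
  qed
qed

end
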